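(* Let $q$ be an odd prime and $d\ge 1$. There is no non-empty proper subset $E\subsetneq \mathbb{F}_q^d$ such that $\psi:=\check{1_E}$, the inverse Fourier transform of the indicator function $1_E$, is the generator of a Parseval wavelet frame for $L^2(\mathbb{F}_q^d)$. That is, for every non-empty $E\subsetneq\mathbb{F}_q^d$, every $\mathcal{A}\subseteq \mathrm{Aut}(\mathbb{F}_q^d)$ and every $\Lambda\subseteq\mathbb{F}_q^d$, the family $\{\delta_a\tau_\lambda\psi : a\in\mathcal{A},\ \lambda\in\Lambda\}$ (indexed by pairs $(a,\lambda)$) is not a Parseval frame for $L^2(\mathbb{F}_q^d)$.
   Context: $\mathbb{F}_q$ is the field with $q$ elements and $\mathrm{Aut}(\mathbb{F}_q^d)$ is the set of automorphisms (invertible linear maps, identified with invertible $d\times d$ matrices) of $\mathbb{F}_q^d$. For $m,x\in\mathbb{F}_q^d$, $\chi_m(x)=e^{2\pi i\, m\cdot x/q}$, where $m\cdot x$ is the usual dot product. For $f:\mathbb{F}_q^d\to\mathbb{C}$ the Fourier transform is $\hat f(\xi)=q^{-d}\sum_{m\in\mathbb{F}_q^d} f(m)\overline{\chi_m(\xi)}$; the inverse Fourier transform is $\check g(x)=\sum_{m\in\mathbb{F}_q^d} g(m)\chi_m(x)$. The inner product on the space $L^2(\mathbb{F}_q^d)$ on which the wavelet system lives is $\langle f,g\rangle=q^{-d}\sum_x f(x)\overline{g(x)}$, while on the Fourier side it is $\sum_m f(m)\overline{g(m)}$, so that $f\mapsto\hat f$ is unitary. The dilation and translation operators are $\delta_a\psi(x)=\psi(ax)$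 and $\tau_t\psi(x)=\psi(x-t)$, so $\delta_a\tau_t\psi(x)=\psi(ax-t)$. A family $\{x_k\}_{k\in I}$ in a Hilbert space $\mathcal{H}$ is a Parseval frame if $\sum_{k\in I}|\langle x,x_k\rangle|^2=\|x\|^2$ for all $x\in\mathcal{H}$. *)

theory Defs
  imports "HOL-Analysis.Analysis" "Berlekamp_Zassenhaus.Finite_Field"
begin

(* For 'q of class prime_card, 'q mod_ring is the prime field with q = CARD('q) elements,
   and 'q mod_ring ^ 'd with CARD('d) = d is its d-dimensional coordinate space. *)

(* to_int_mod_ring picks the representative in {0..<q}; the value of the character does not
   depend on this choice. *)
definition additive_char ::
    "'q::prime_card mod_ring ^ 'd::finite \<Rightarrow> 'q mod_ring ^ 'd \<Rightarrow> complex" where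
  "additive_char m x =
     exp (2 * of_real pi * \<i> * of_int (to_int_mod_ring (scalar_product m x)) / of_nat CARD('q))"

definition inverse_fourier ::
    "('q::prime_card mod_ring ^ 'd::finite \<Rightarrow> complex) \<Rightarrow> 'q mod_ring ^ 'd \<Rightarrow> complex" where
  "inverse_fourier g x = (\<Sum>m\<in>UNIV. g m * additive_char m x)"

(* Since the domain is finite, every function belongs to L2, so L2 is the whole function type. *)
definition L2_inner ::
    "('q::prime_card mod_ring ^ 'd::finite \<Rightarrow> complex) \<Rightarrow> ('q mod_ring ^ 'd \<Rightarrow> complex) \<Rightarrow> complex"
  where
  "L2_inner f g = (\<Sum>x\<in>UNIV. f x * cnj (g x)) / of_nat (CARD('q) ^ CARD('d))"

definition L2_norm :: "('q::prime_card mod_ring ^ 'd::finite \<Rightarrow> complex) \<Rightarrow> real" where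
  "L2_norm f = sqrt (Re (L2_inner f f))"

definition L2_parseval_frame ::
    "'i set \<Rightarrow> ('i \<Rightarrow> 'q::prime_card mod_ring ^ 'd::finite \<Rightarrow> complex) \<Rightarrow> bool" where
  "L2_parseval_frame I u \<longleftrightarrow>
     (\<forall>f. ((\<lambda>k. (cmod (L2_inner f (u k)))\<^sup>2) has_sum (L2_norm f)\<^sup>2) I)"

definition dilation ::
    "'q::prime_card mod_ring ^ 'd::finite ^ 'd \<Rightarrow> ('q mod_ring ^ 'd \<Rightarrow> complex)
       \<Rightarrow> 'q mod_ring ^ 'd \<Rightarrow> complex" where
  "dilation a f x = f (a *v x)"

definition translation ::
    "'q::prime_card mod_ring ^ 'd::finite \<Rightarrow> ('q mod_ring ^ 'd \<Rightarrow> complex)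
       \<Rightarrow> 'q mod_ring ^ 'd \<Rightarrow> complex" where
  "translation t f x = f (x - t)"

(* The system is indexed by pairs, so coinciding functions are counted with multiplicity. *)
definition parseval_wavelet_system ::
    "('q::prime_card mod_ring ^ 'd::finite ^ 'd) set \<Rightarrow> ('q mod_ring ^ 'd) set
       \<Rightarrow> ('q mod_ring ^ 'd \<Rightarrow> complex) \<Rightarrow> bool" where
  "parseval_wavelet_system \<A> \<Lambda> \<psi> \<longleftrightarrow>
     L2_parseval_frame (\<A> \<times> \<Lambda>) (\<lambda>(a, t). dilation a (translation t \<psi>))"

end

theory Submission
  imports Defs
begin

text \<open>
  Testing the Parseval identity on just two unit vectors gives a contradiction. Write \<open>\<chi>\<^sub>m\<close> for the
  character of frequency \<open>m\<close> and \<open>\<psi> = \<Sum>\<^bsub>m \<in> E\<^esub> \<chi>\<^sub>m\<close>. The characters are orthonormal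
  (\<open>L2_inner_additive_char\<close>), so \<open>\<langle>\<chi>\<^sub>m, \<psi>\<rangle>\<close> is \<open>1\<close> if \<open>m \<in> E\<close> and \<open>0\<close> otherwise
  (\<open>L2_inner_additive_char_inverse_fourier\<close>). Moreover each \<open>\<delta>\<^sub>a \<tau>\<^sub>t\<close> with invertible \<open>a\<close> is unitary,
  because it permutes the points of the space (\<open>L2_inner_dilation_translation\<close>).

  The first test vector is the constant \<open>\<chi>\<^sub>0 = 1\<close>. Every \<open>\<delta>\<^sub>a \<tau>\<^sub>t\<close> fixes it, so its inner products with
  all the members of the system equal \<open>\<langle>\<chi>\<^sub>0, \<psi>\<rangle>\<close>. If \<open>0 \<notin> E\<close> their squares sum to \<open>0\<close>; otherwise they sum to
  the number of pairs \<open>(a, t)\<close>. As the squared norm of \<open>\<chi>\<^sub>0\<close> is \<open>1\<close>, a Parseval system must consist of a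
  single vector \<open>\<delta>\<^sub>a \<tau>\<^sub>t \<psi>\<close>. The second test vector is \<open>\<delta>\<^sub>a \<tau>\<^sub>t \<chi>\<^sub>\<xi>\<close> with \<open>\<xi> \<notin> E\<close>: it has norm \<open>1\<close>, but it
  is orthogonal to that single vector, because \<open>\<langle>\<chi>\<^sub>\<xi>, \<psi>\<rangle> = 0\<close>.
\<close>

definition standard_char :: "'q::prime_card mod_ring \<Rightarrow> complex" where
  "standard_char z = exp (2 * of_real pi * \<i> * of_int (to_int_mod_ring z) / of_nat CARD('q))"

lemma additive_char_eq_standard_char: "additive_char m x = standard_char (scalar_product m x)"
  by (simp add: additive_char_def standard_char_def)

lemma standard_char_0 [simp]: "standard_char 0 = 1"
  by (simp add: standard_char_def)

text \<open>Representatives of \<open>y\<close>, \<open>z\<close> and \<open>y + z\<close> match only up to a multiple of \<open>q\<close>, which contributes a full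
  period of the exponential.\<close>

lemma standard_char_add:
  fixes y z :: "'q::prime_card mod_ring"
  shows "standard_char (y + z) = standard_char y * standard_char z"
proof -
  let ?n = "to_int_mod_ring y + to_int_mod_ring z"
  let ?e = "\<lambda>n. exp (2 * of_real pi * \<i> * of_int n / of_nat CARD('q))"
  define k where "k = ?n div int CARD('q)"
  have n: "?n = to_int_mod_ring (y + z) + int CARD('q) * k"
    by (simp add: to_int_mod_ring_add k_def)
  have "2 * of_real pi * \<i> * of_int ?n / of_nat CARD('q) =
      2 * of_real pi * \<i> * of_int (to_int_mod_ring (y + z)) / of_nat CARD('q)
      + 2 * of_real pi * \<i> * of_int k"
    unfolding n by (simp add: field_simps)
  moreover have "exp (2 * of_real pi * \<i> * of_int k) = 1"
    by (auto simp: exp_eq_1)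
  ultimately have "?e ?n = standard_char (y + z)"
    by (simp add: standard_char_def exp_add)
  then show ?thesis
    by (simp add: standard_char_def exp_add [symmetric] field_simps)
qed

lemma cnj_standard_char: "cnj (standard_char z) = standard_char (- z)"
proof -
  have "standard_char z * standard_char (- z) = 1"
    by (simp flip: standard_char_add)
  moreover have "cnj (standard_char z) * standard_char z = 1"
    by (simp add: standard_char_def exp_cnj flip: exp_add)
  ultimately show ?thesis
    by (metis mult.assoc mult.right_neutral mult.left_neutral)
qed

lemma standard_char_eq_1_iff:
  fixes z :: "'q::prime_card mod_ring"
  shows "standard_char z = 1 \<longleftrightarrow> z = 0"
proof
  assume "standard_char z = 1"
  then obtain n :: int where "2 * pi * to_int_mod_ring z / CARD('q) = of_int (2 * n) * pi"
    by (auto simp: standard_char_def exp_eq_1)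
  then have "of_int (to_int_mod_ring z) = (of_int (n * int CARD('q)) :: real)"
    by (simp add: field_simps)
  then have n: "to_int_mod_ring z = n * int CARD('q)"
    by linarith
  have "to_int_mod_ring z \<in> {0..<int CARD('q)}"
    using range_to_int_mod_ring by blast
  with n have "to_int_mod_ring z = 0"
    by (metis atLeastLessThan_iff mod_mult_self2_is_0 mod_pos_pos_trivial)
  then show "z = 0"
    by simp
qed simp

lemma additive_char_add_right:
  "additive_char m (x + y) = additive_char m x * additive_char m y"
  by (simp add: additive_char_eq_standard_char scalar_product_def distrib_left sum.distrib
      flip: standard_char_add)

lemma additive_char_0_left [simp]: "additive_char 0 = (\<lambda>x. 1)"
  by (simp add: fun_eq_iff additive_char_eq_standard_char scalar_product_def)

lemma additive_char_mult_cnj: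
  "additive_char m x * cnj (additive_char n x) = additive_char (m - n) x"
  by (simp add: additive_char_eq_standard_char cnj_standard_char scalar_product_def
      left_diff_distrib sum_subtractf flip: standard_char_add)

text \<open>Translating by a coordinate vector on which the character is not \<open>1\<close> multiplies the sum by a
  factor other than \<open>1\<close>, yet only permutes its terms.\<close>

lemma sum_additive_char_eq_0:
  fixes m :: "'q::prime_card mod_ring ^ 'd::finite"
  assumes "m \<noteq> 0"
  shows "(\<Sum>x\<in>UNIV. additive_char m x) = 0"
proof -
  from assms obtain i where i: "m $ i \<noteq> 0"
    by (auto simp: vec_eq_iff)
  define y :: "'q mod_ring ^ 'd" where "y = axis i 1"
  have "scalar_product m y = m $ i"
    by (simp add: y_def scalar_product_def axis_def if_distrib cong: if_cong)
  with i have y: "additive_char m y \<noteq> 1"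
    by (simp add: additive_char_eq_standard_char standard_char_eq_1_iff)
  have "(\<Sum>x\<in>UNIV. additive_char m x) = (\<Sum>x\<in>UNIV. additive_char m (x + y))"
    by (rule sum.reindex_bij_witness [of _ "\<lambda>x. x + y" "\<lambda>x. x - y"]) auto
  also have "\<dots> = (\<Sum>x\<in>UNIV. additive_char m x) * additive_char m y"
    by (simp add: additive_char_add_right sum_distrib_right)
  finally show ?thesis
    using y by (metis mult_cancel_left2)
qed

lemma L2_inner_additive_char:
  fixes m n :: "'q::prime_card mod_ring ^ 'd::finite"
  shows "L2_inner (additive_char m) (additive_char n) = of_bool (m = n)"
  by (auto simp: L2_inner_def additive_char_mult_cnj sum_additive_char_eq_0 CARD_vec)

lemma L2_inner_additive_char_inverse_fourier:
  fixes m :: "'q::prime_card mod_ring ^ 'd::finite"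
  shows "L2_inner (additive_char m) (inverse_fourier g) = cnj (g m)"
proof -
  have "L2_inner (additive_char m) (inverse_fourier g) =
      (\<Sum>x\<in>UNIV. \<Sum>n\<in>UNIV. cnj (g n) * (additive_char m x * cnj (additive_char n x)))
      / of_nat (CARD('q) ^ CARD('d))"
    by (simp add: L2_inner_def inverse_fourier_def sum_distrib_left mult_ac)
  also have "\<dots> = (\<Sum>n\<in>UNIV. cnj (g n) * L2_inner (additive_char m) (additive_char n))"
    by (subst sum.swap) (simp add: L2_inner_def sum_distrib_left sum_divide_distrib)
  also have "\<dots> = cnj (g m)"
    by (simp add: L2_inner_additive_char of_bool_def if_distrib cong: if_cong)
  finally show ?thesis .
qed

lemma L2_inner_dilation_translation:
  fixes a :: "'q::prime_card mod_ring ^ 'd::finite ^ 'd"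
  assumes "invertible a"
  shows "L2_inner (dilation a (translation t f)) (dilation a (translation t g)) = L2_inner f g"
proof -
  from assms obtain b where ab: "a ** b = mat 1" and ba: "b ** a = mat 1"
    by (auto simp: invertible_def)
  have "(\<Sum>x\<in>UNIV. f (a *v x - t) * cnj (g (a *v x - t))) = (\<Sum>y\<in>UNIV. f y * cnj (g y))"
    by (rule sum.reindex_bij_witness [of _ "\<lambda>y. b *v (y + t)" "\<lambda>x. a *v x - t"])
      (auto simp: matrix_vector_mul_assoc ab ba)
  then show ?thesis
    by (simp add: L2_inner_def dilation_def translation_def)
qed

theorem theorem2p3:
  fixes E :: "('q::prime_card mod_ring ^ 'd::finite) set"
    and \<A> :: "('q mod_ring ^ 'd ^ 'd) set"
    and \<Lambda> :: "('q mod_ring ^ 'd) set"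
  assumes "odd CARD('q)"
    and "E \<noteq> {}" and "E \<subset> UNIV"
    and "\<A> \<subseteq> {a. invertible a}"
  shows "\<not> parseval_wavelet_system \<A> \<Lambda> (inverse_fourier (indicator E))"
proof
  define \<psi> :: "'q mod_ring ^ 'd \<Rightarrow> complex" where "\<psi> = inverse_fourier (indicator E)"
  define u where "u = (\<lambda>(a, t). dilation a (translation t \<psi>))"
  assume "parseval_wavelet_system \<A> \<Lambda> (inverse_fourier (indicator E))"
  then have "((\<lambda>k. (cmod (L2_inner f (u k)))\<^sup>2) has_sum (L2_norm f)\<^sup>2) (\<A> \<times> \<Lambda>)" for f
    by (simp add: parseval_wavelet_system_def L2_parseval_frame_def u_def \<psi>_def)
  then have parseval: "(L2_norm f)\<^sup>2 = (\<Sum>k\<in>\<A> \<times> \<Lambda>. (cmod (L2_inner f (u k)))\<^sup>2)" for f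
    by (metis has_sum_finite has_sum_unique finite)
  have test: "L2_inner (dilation a (translation t (additive_char m))) (u (a, t)) = indicator E m"
    if "a \<in> \<A>" for a t m
    using that assms(4)
    by (auto simp: u_def L2_inner_dilation_translation \<psi>_def
        L2_inner_additive_char_inverse_fourier indicator_def)
  have unit: "L2_norm (dilation a (translation t (additive_char m))) = 1" if "a \<in> \<A>" for a t m
    using that assms(4)
    by (auto simp: L2_norm_def L2_inner_dilation_translation L2_inner_additive_char)
  have "dilation a (translation t (additive_char 0)) = additive_char 0"
    for a :: "'q mod_ring ^ 'd ^ 'd" and t
    by (simp add: fun_eq_iff dilation_def translation_def)
  then have "L2_inner (additive_char 0) (u k) = indicator E 0" if "k \<in> \<A> \<times> \<Lambda>" for k
    using that test [of "fst k" "snd k" 0] by auto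
  then have "(L2_norm (additive_char (0 :: 'q mod_ring ^ 'd)))\<^sup>2 =
      of_nat (card (\<A> \<times> \<Lambda>)) * (cmod (indicator E (0 :: 'q mod_ring ^ 'd)))\<^sup>2"
    by (simp add: parseval del: additive_char_0_left)
  moreover have "L2_norm (additive_char (0 :: 'q mod_ring ^ 'd)) = 1"
    by (simp add: L2_norm_def L2_inner_additive_char del: additive_char_0_left)
  ultimately have "real (card (\<A> \<times> \<Lambda>)) = 1"
    by (cases "0 \<in> E") (simp_all del: additive_char_0_left)
  then have "card (\<A> \<times> \<Lambda>) = 1"
    by (simp only: of_nat_eq_1_iff)
  then obtain a t where single: "\<A> \<times> \<Lambda> = {(a, t)}"
    by (metis card_1_singletonE surj_pair)
  then have a: "a \<in> \<A>"
    by blast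
  from assms(3) obtain \<xi> where "\<xi> \<notin> E"
    by blast
  with test [OF a] parseval [of "dilation a (translation t (additive_char \<xi>))"]
  show False
    by (simp add: single unit [OF a])
qed

end
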